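(* Let $G=(V,E)$ be a connected finite simple graph with at least one edge, let $\mu$ be the smallest nonzero eigenvalue of problem (AC), $\vec x$ a corresponding eigenvector, and $c_x\in\mathrm{median}(\vec x)$. Then: (a) if $c_x=\|\vec x\|_\infty$, then $r^0\le2$ and $r^-\le1$; (b) if $c_x=-\|\vec x\|_\infty$, then $r^0\le2$ and $r^+\le1$; (c) if $|c_x|<\|\vec x\|_\infty$, then $r^+\le1$ and $r^-\le1$.
   Context: $V=\{1,\dots,n\}$, unit edge weights, $d_i$ degree, $\mathrm{vol}(V)=\sum_id_i$. $N(\vec x)=\min_{t}\sum_i d_i|x_i-t|$, $\mathrm{median}(\vec x)$ the set of minimizers $t$. $\mathrm{Sgn}(t)=\{1\},[-1,1],\{-1\}$ for $t>0,t=0,t<0$; $(\Delta_1\vec x)_i=\{\sum_{j:\{i,j\}\in E}z_{ij}: z_{ij}\in\mathrm{Sgn}(x_i-x_j),z_{ij}=-z_{ji}\}$. Problem (AC): $(\mu,\vec x)$ with $\vec x\ne\vec0$ and $\vec 0\in\Delta_1\vec x-2\mu\,\mathrm{vol}(V)\,\partial\|\vec x\|_\infty+\mu\,\partial N(\vec x)$. $D_\pm(\vec x)=\{i:\pm x_i=\|\vec x\|_\infty\}$, $D_0(\vec x)=\{i:|x_i|<\|\vec x\|_\infty\}$; $r^+$, $r^-$, $r^0$ denote the numbers of connected components of the subgraphs induced by $D_+(\vec x)$, $D_-(\vec x)$, $D_0(\vec x)$ respectively. *)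

theory Defs
  imports "HOL-Analysis.Analysis" "Graph_Theory.Digraph_Component"
begin

text \<open>
  Finite simple graphs are \<^locale>\<open>pair_graph\<close>s, i.e. finite symmetric loopfree digraphs whose arcs
  are pairs of vertices: an edge \<open>{i, j}\<close> is the pair of arcs \<open>(i, j)\<close> and \<open>(j, i)\<close>. The vertex set
  is the whole finite type \<open>'n\<close>, which also indexes the coordinates of the vectors.
\<close>

definition deg :: "'n pair_pre_digraph \<Rightarrow> 'n \<Rightarrow> real" where
  "deg G i = real (out_degree (with_proj G) i)"

definition vol :: "'n::finite pair_pre_digraph \<Rightarrow> real" where
  "vol G = (\<Sum>i\<in>UNIV. deg G i)"

definition dev :: "'n::finite pair_pre_digraph \<Rightarrow> real ^ 'n \<Rightarrow> real \<Rightarrow> real" where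
  "dev G x t = (\<Sum>i\<in>UNIV. deg G i * \<bar>x $ i - t\<bar>)"

text \<open>The infimum is a minimum, see \<open>N_attained\<close> below.\<close>

definition N :: "'n::finite pair_pre_digraph \<Rightarrow> real ^ 'n \<Rightarrow> real" where
  "N G x = (INF t. dev G x t)"

definition median :: "'n::finite pair_pre_digraph \<Rightarrow> real ^ 'n \<Rightarrow> real set" where
  "median G x = {t. is_arg_min (dev G x) (\<lambda>_. True) t}"

definition subdifferential :: "('a::real_inner \<Rightarrow> real) \<Rightarrow> 'a \<Rightarrow> 'a set" where
  "subdifferential f x = {s. \<forall>y. f x + s \<bullet> (y - x) \<le> f y}"

definition Sgn :: "real \<Rightarrow> real set" where
  "Sgn t = (if t > 0 then {1} else if t < 0 then {-1} else {-1..1})"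

text \<open>One antisymmetric family \<open>z\<close> serves all coordinates simultaneously.\<close>

definition Delta1 :: "'n::finite pair_pre_digraph \<Rightarrow> real ^ 'n \<Rightarrow> (real ^ 'n) set" where
  "Delta1 G x = {(\<chi> i. \<Sum>j | (i, j) \<in> parcs G. z i j) | z.
     \<forall>i j. (i, j) \<in> parcs G \<longrightarrow> z i j \<in> Sgn (x $ i - x $ j) \<and> z i j = - z j i}"

definition AC_eigenpair :: "'n::finite pair_pre_digraph \<Rightarrow> real \<Rightarrow> real ^ 'n \<Rightarrow> bool" where
  "AC_eigenpair G \<mu> x \<longleftrightarrow> x \<noteq> 0 \<and>
     0 \<in> {a - (2 * \<mu> * vol G) *\<^sub>R b + \<mu> *\<^sub>R c | a b c.
           a \<in> Delta1 G x \<and> b \<in> subdifferential infnorm x \<and> c \<in> subdifferential (N G) x}"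

definition AC_eigenvalue :: "'n::finite pair_pre_digraph \<Rightarrow> real \<Rightarrow> bool" where
  "AC_eigenvalue G \<mu> \<longleftrightarrow> (\<exists>x. AC_eigenpair G \<mu> x)"

definition D_plus :: "real ^ 'n::finite \<Rightarrow> 'n set" where
  "D_plus x = {i. x $ i = infnorm x}"

definition D_minus :: "real ^ 'n::finite \<Rightarrow> 'n set" where
  "D_minus x = {i. - (x $ i) = infnorm x}"

definition D_zero :: "real ^ 'n::finite \<Rightarrow> 'n set" where
  "D_zero x = {i. \<bar>x $ i\<bar> < infnorm x}"

text \<open>
  The components of the induced subgraph are its maximal connected subgraphs; as connected graphs
  are nonempty by definition, the count is 0 for empty \<open>S\<close>. The qualified name avoids the
  topological notion of connectedness.
\<close>

definition num_components :: "'n pair_pre_digraph \<Rightarrow> 'n set \<Rightarrow> nat" where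
  "num_components G S =
     card {H. pre_digraph.max_subgraph (with_proj G \<restriction> S) Digraph_Component.connected H}"

lemma median_nonempty: "median G x \<noteq> {}"
proof -
  define M where "M = (\<Sum>i\<in>UNIV. \<bar>x $ i\<bar>)"
  have M: "\<bar>x $ i\<bar> \<le> M" for i
    unfolding M_def by (rule member_le_sum) auto
  have "continuous_on {-M..M} (dev G x)"
    unfolding dev_def by (intro continuous_intros)
  moreover have "{-M..M} \<noteq> {}"
    using M[of undefined] by auto
  ultimately obtain t where t: "\<And>s. s \<in> {-M..M} \<Longrightarrow> dev G x t \<le> dev G x s"
    by (metis continuous_attains_inf compact_Icc)
  have "dev G x t \<le> dev G x s" for s
  proof -
    have "dev G x t \<le> dev G x (max (-M) (min M s))"
      using M[of undefined] by (intro t) auto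
    also have "\<dots> \<le> dev G x s"
      unfolding dev_def
    proof (intro sum_mono mult_left_mono)
      fix i
      show "\<bar>x $ i - max (-M) (min M s)\<bar> \<le> \<bar>x $ i - s\<bar>"
        using M[of i] by (auto simp: max_def min_def abs_if split: if_splits)
    qed (simp add: deg_def)
    finally show ?thesis .
  qed
  then have "t \<in> median G x"
    by (auto simp: median_def is_arg_min_def not_less)
  then show ?thesis by blast
qed

lemma N_attained: "t \<in> median G x \<Longrightarrow> N G x = dev G x t"
  unfolding N_def median_def is_arg_min_def
  by (rule cInf_eq_minimum) (auto simp: not_less)

end

theory Submission
  imports Defs
begin

text \<open>
  Every cut \<open>(S, - S)\<close> with both sides nonempty yields an eigenvector with values in \<open>{1, - 1}\<close>, with
  eigenvalue \<open>|\<partial>S| / max (vol S) (vol (- S))\<close>; hence \<open>\<mu> * vol (- A) \<le> |\<partial>A|\<close> for every nonempty \<open>A\<close>.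
  On the other hand, summing the eigenvalue equation of \<open>x\<close> over a component \<open>A\<close> of \<open>D_plus x\<close>, with the
  median below the maximum, gives \<open>|\<partial>A| = \<mu> * (2 * vol G * u(A) - vol A)\<close> for a subgradient \<open>u\<close> of the
  norm, so \<open>u(A) \<ge> 1 / 2\<close>. As \<open>u\<close> has total \<open>0\<close> and \<open>l\<^sup>1\<close>-norm at most 1, no set has weight above
  \<open>1 / 2\<close>, which leaves room for one component. If the median is the maximum, each component \<open>A\<close> of
  \<open>D_zero x\<close> sends \<open>\<mu> * vol A\<close> more edges to \<open>D_minus x\<close> than to \<open>D_plus x\<close>, hence at least
  \<open>\<mu> * vol G / 2\<close> to \<open>D_minus x\<close>, whose boundary has at most \<open>\<mu> * vol G\<close> edges. The remaining cases
  follow by passing to \<open>- x\<close>.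
\<close>

section \<open>Edge cuts and antisymmetric flows\<close>

text \<open>For symmetric \<open>E\<close> and disjoint \<open>A\<close>, \<open>B\<close> this is
  the number of edges between them, so \<open>edge_cut E A (- A)\<close> is |\<partial>A|. The form
  as a double sum of indicators lets it be compared termwise with sums of a flow.\<close>

definition edge_cut :: "('a \<times> 'a) set \<Rightarrow> 'a set \<Rightarrow> 'a set \<Rightarrow> real" where
  "edge_cut E A B = (\<Sum>i\<in>A. \<Sum>j\<in>B. of_bool ((i, j) \<in> E))"

lemma edge_cut_commute:
  assumes "sym E"
  shows "edge_cut E A B = edge_cut E B A"
proof -
  have "(i, j) \<in> E \<longleftrightarrow> (j, i) \<in> E" for i j
    using assms by (auto dest: symD)
  then show ?thesis
    unfolding edge_cut_def by (subst sum.swap) simp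
qed

lemma edge_cut_mono:
  assumes "finite A'" "finite B'" "A \<subseteq> A'" "B \<subseteq> B'"
  shows "edge_cut E A B \<le> edge_cut E A' B'"
proof -
  have "edge_cut E A B \<le> (\<Sum>i\<in>A. \<Sum>j\<in>B'. of_bool ((i, j) \<in> E))"
    unfolding edge_cut_def using assms by (intro sum_mono sum_mono2) auto
  also have "\<dots> \<le> edge_cut E A' B'"
    unfolding edge_cut_def using assms by (intro sum_mono2 sum_nonneg) auto
  finally show ?thesis .
qed

lemma edge_cut_Union_left:
  assumes "finite \<C>" "\<And>A. A \<in> \<C> \<Longrightarrow> finite A" "disjoint \<C>"
  shows "edge_cut E (\<Union>\<C>) B = (\<Sum>A\<in>\<C>. edge_cut E A B)"
  unfolding edge_cut_def using assms
  by (subst sum.Union_disjoint) (auto simp: disjoint_def)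

lemma sum_antisym_eq_0:
  fixes w :: "'a \<Rightarrow> 'a \<Rightarrow> real"
  assumes "\<And>i j. w i j = - w j i"
  shows "(\<Sum>i\<in>A. \<Sum>j\<in>A. w i j) = 0"
proof -
  have "(\<Sum>i\<in>A. \<Sum>j\<in>A. w i j) = (\<Sum>j\<in>A. \<Sum>i\<in>A. w i j)"
    by (rule sum.swap)
  also have "\<dots> = (\<Sum>j\<in>A. \<Sum>i\<in>A. - w j i)"
    by (intro sum.cong refl) (rule assms)
  also have "\<dots> = - (\<Sum>i\<in>A. \<Sum>j\<in>A. w i j)"
    by (simp add: sum_negf)
  finally show ?thesis by simp
qed

text \<open>A discrete divergence theorem: the flow between vertices of \<open>A\<close> cancels in
  pairs.\<close>

lemma sum_antisym_boundary:
  fixes w :: "'a::finite \<Rightarrow> 'a \<Rightarrow> real"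
  assumes "\<And>i j. w i j = - w j i"
  shows "(\<Sum>i\<in>A. \<Sum>j\<in>UNIV. w i j) = (\<Sum>i\<in>A. \<Sum>j\<in>- A. w i j)"
proof -
  have "(\<Sum>j\<in>UNIV. w i j) = (\<Sum>j\<in>A. w i j) + (\<Sum>j\<in>- A. w i j)" for i
    by (subst sum.union_disjoint[symmetric]) (auto simp: Compl_partition)
  then have "(\<Sum>i\<in>A. \<Sum>j\<in>UNIV. w i j)
      = (\<Sum>i\<in>A. \<Sum>j\<in>A. w i j) + (\<Sum>i\<in>A. \<Sum>j\<in>- A. w i j)"
    by (simp add: sum.distrib)
  then show ?thesis
    by (simp add: sum_antisym_eq_0[OF assms])
qed

text \<open>Summation by parts. It exposes the energy of a flow along \<open>x\<close>, whose terms
  are nonnegative when the flow follows the signs of the differences of \<open>x\<close>.\<close>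

lemma sum_antisym_weighted:
  fixes w :: "'a \<Rightarrow> 'a \<Rightarrow> real" and x :: "'a \<Rightarrow> real"
  assumes "\<And>i j. w i j = - w j i"
  shows "2 * (\<Sum>i\<in>A. (\<Sum>j\<in>A. w i j) * x i) = (\<Sum>i\<in>A. \<Sum>j\<in>A. w i j * (x i - x j))"
proof -
  have "(\<Sum>i\<in>A. \<Sum>j\<in>A. w i j * x j) = (\<Sum>j\<in>A. \<Sum>i\<in>A. w i j * x j)"
    by (rule sum.swap)
  also have "\<dots> = (\<Sum>j\<in>A. \<Sum>i\<in>A. - (w j i * x j))"
    by (intro sum.cong refl) (metis assms minus_mult_left)
  also have "\<dots> = - (\<Sum>i\<in>A. \<Sum>j\<in>A. w i j * x i)"
    by (simp add: sum_negf)
  finally show ?thesis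
    by (simp add: right_diff_distrib sum_subtractf sum_distrib_right)
qed

section \<open>Subgradients of the norm and of \<open>N\<close>\<close>

lemma infnorm_le_cart:
  fixes x :: "real ^ 'n"
  assumes "\<And>i. \<bar>x $ i\<bar> \<le> b"
  shows "infnorm x \<le> b"
  unfolding infnorm_cart using assms by (intro cSup_least) auto

lemma subdifferential_uminus:
  assumes "\<And>y. f (- y) = f y"
  shows "- s \<in> subdifferential f (- x) \<longleftrightarrow> s \<in> subdifferential f x"
proof -
  have "(\<forall>y. f (- x) + - s \<bullet> (y - - x) \<le> f y) \<longleftrightarrow> (\<forall>y. f (- x) + - s \<bullet> (- y - - x) \<le> f (- y))"
    by (metis minus_minus)
  also have "\<dots> \<longleftrightarrow> (\<forall>y. f x + s \<bullet> (y - x) \<le> f y)"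
    by (simp add: assms algebra_simps)
  finally show ?thesis
    by (simp add: subdifferential_def)
qed

text \<open>Norm duality: a subgradient lies in the unit ball of the dual norm, here the l1 norm,
  and attains the norm at \<open>x\<close>.\<close>

lemma subdifferential_infnorm:
  fixes x u :: "real ^ 'n"
  shows "u \<in> subdifferential infnorm x \<longleftrightarrow> (\<Sum>i\<in>UNIV. \<bar>u $ i\<bar>) \<le> 1 \<and> u \<bullet> x = infnorm x"
proof
  assume u: "u \<in> subdifferential infnorm x"
  \<comment> \<open>By homogeneity, doubling \<open>x\<close> bounds \<open>u \<bullet> x\<close>
    from above and shrinking it to 0 bounds it from below.\<close>
  have "infnorm x + u \<bullet> (2 *\<^sub>R x - x) \<le> infnorm (2 *\<^sub>R x)"
       "infnorm x + u \<bullet> (0 - x) \<le> infnorm (0 :: real ^ 'n)"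
    using u unfolding subdifferential_def by blast+
  then have ux: "u \<bullet> x = infnorm x"
    by (simp add: infnorm_mul infnorm_0 algebra_simps)
  \<comment> \<open>The sign vector of \<open>u\<close> is the test vector at which the l1 norm of
    \<open>u\<close> is read off.\<close>
  define y :: "real ^ 'n" where "y = (\<chi> i. sgn (u $ i))"
  have "infnorm x + u \<bullet> (y - x) \<le> infnorm y"
    using u unfolding subdifferential_def by blast
  then have "u \<bullet> y \<le> infnorm y"
    using ux by (simp add: algebra_simps)
  also have "infnorm y \<le> 1"
    by (rule infnorm_le_cart) (simp add: y_def sgn_real_def)
  also have "u \<bullet> y = (\<Sum>i\<in>UNIV. \<bar>u $ i\<bar>)"
    by (simp add: y_def inner_vec_def abs_sgn)
  finally show "(\<Sum>i\<in>UNIV. \<bar>u $ i\<bar>) \<le> 1 \<and> u \<bullet> x = infnorm x"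
    using ux by simp
next
  assume u: "(\<Sum>i\<in>UNIV. \<bar>u $ i\<bar>) \<le> 1 \<and> u \<bullet> x = infnorm x"
  have "u \<bullet> y \<le> infnorm y" for y
  proof -
    have "u \<bullet> y \<le> (\<Sum>i\<in>UNIV. \<bar>u $ i\<bar> * infnorm y)"
      unfolding inner_vec_def
    proof (rule sum_mono)
      fix i
      have "u $ i \<bullet> y $ i \<le> \<bar>u $ i\<bar> * \<bar>y $ i\<bar>"
        by (simp flip: abs_mult)
      also have "\<dots> \<le> \<bar>u $ i\<bar> * infnorm y"
        by (intro mult_left_mono component_le_infnorm_cart) auto
      finally show "u $ i \<bullet> y $ i \<le> \<bar>u $ i\<bar> * infnorm y" .
    qed
    also have "\<dots> \<le> infnorm y"
      using u by (simp add: infnorm_pos_le mult_left_le_one_le sum_nonneg flip: sum_distrib_right)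
    finally show ?thesis .
  qed
  then show "u \<in> subdifferential infnorm x"
    using u by (simp add: subdifferential_def algebra_simps)
qed

lemma deg_nonneg: "0 \<le> deg G i"
  by (simp add: deg_def)

lemma N_le_dev: "N G x \<le> dev G x t"
proof -
  obtain s where "s \<in> median G x"
    using median_nonempty by blast
  then show ?thesis
    using N_attained[of s G x] by (auto simp: median_def is_arg_min_def not_less)
qed

lemma dev_uminus: "dev G (- x) t = dev G x (- t)"
  unfolding dev_def by (intro sum.cong arg_cong2[where f = "(*)"] refl) (simp add: abs_minus_commute add.commute)

lemma N_uminus: "N G (- x) = N G x"
proof (rule antisym)
  have le: "N G (- x) \<le> N G x" for x
  proof -
    obtain s where "s \<in> median G x"
      using median_nonempty by blast
    then show ?thesis
      using N_attained[of s G x] N_le_dev[of G "- x" "- s"] by (simp add: dev_uminus)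
  qed
  show "N G (- x) \<le> N G x" by (rule le)
  show "N G x \<le> N G (- x)" using le[of "- x"] by simp
qed

lemma median_uminus: "c \<in> median G x \<Longrightarrow> - c \<in> median G (- x)"
  by (auto simp: median_def is_arg_min_def dev_uminus)

text \<open>Perturbing one coordinate with \<open>c\<close> held fixed makes \<open>v $ i\<close> a
  subgradient of the weighted distance to \<open>c\<close> at \<open>x $ i\<close>, which gives the
  first three claims. The last one comes from translation invariance.\<close>

lemma subdifferential_N_D:
  fixes x v :: "real ^ 'n::finite"
  assumes v: "v \<in> subdifferential (N G) x" and c: "c \<in> median G x"
  shows "\<bar>v $ i\<bar> \<le> deg G i"
    and "x $ i > c \<Longrightarrow> v $ i = deg G i"
    and "x $ i < c \<Longrightarrow> v $ i = - deg G i"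
    and "(\<Sum>i\<in>UNIV. v $ i) = 0"
proof -
  \<comment> \<open>\<open>N\<close> equals \<open>dev\<close> at the median \<open>c\<close> of
    \<open>x\<close>, but after the perturbation any \<open>t\<close> still gives an upper
    bound.\<close>
  have key: "v \<bullet> h \<le> dev G (x + h) t - dev G x c" for h t
  proof -
    have "N G x + v \<bullet> (x + h - x) \<le> N G (x + h)"
      using v unfolding subdifferential_def by blast
    then show ?thesis
      using N_attained[OF c] N_le_dev[of G "x + h" t] by simp
  qed
  have coord: "v $ i * a \<le> deg G i * (\<bar>x $ i + a - c\<bar> - \<bar>x $ i - c\<bar>)" for a
  proof -
    have "dev G (x + axis i a) c - dev G x c
        = (\<Sum>j\<in>UNIV. deg G j * (\<bar>x $ j + axis i a $ j - c\<bar> - \<bar>x $ j - c\<bar>))"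
      by (simp add: dev_def algebra_simps flip: sum_subtractf)
    also have "\<dots> = (\<Sum>j\<in>UNIV. if j = i then deg G i * (\<bar>x $ i + a - c\<bar> - \<bar>x $ i - c\<bar>) else 0)"
      by (intro sum.cong) (auto simp: axis_def)
    also have "\<dots> = deg G i * (\<bar>x $ i + a - c\<bar> - \<bar>x $ i - c\<bar>)"
      by simp
    finally show ?thesis
      using key[of "axis i a" c] by (simp add: inner_axis)
  qed
  have lip: "deg G i * (\<bar>x $ i + a - c\<bar> - \<bar>x $ i - c\<bar>) \<le> deg G i * \<bar>a\<bar>" for a
    by (intro mult_left_mono deg_nonneg) auto
  show le: "\<bar>v $ i\<bar> \<le> deg G i"
    using coord[of 1] coord[of "-1"] lip[of 1] lip[of "-1"] by (simp add: abs_le_iff)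
  show "v $ i = deg G i" if "x $ i > c"
  proof -
    \<comment> \<open>Moving coordinate \<open>i\<close> onto \<open>c\<close> makes its distance
      vanish, so the slope has to be extremal.\<close>
    have "(deg G i - v $ i) * (x $ i - c) \<le> 0"
      using coord[of "c - x $ i"] that by (simp add: algebra_simps)
    then show ?thesis
      using le that by (simp add: mult_le_0_iff)
  qed
  show "v $ i = - deg G i" if "x $ i < c"
  proof -
    have "(deg G i + v $ i) * (c - x $ i) \<le> 0"
      using coord[of "c - x $ i"] that by (simp add: algebra_simps)
    then show ?thesis
      using le that by (simp add: mult_le_0_iff)
  qed
  \<comment> \<open>Translating \<open>x\<close> and \<open>t\<close> by the same \<open>a\<close>
    leaves \<open>dev\<close> unchanged.\<close>
  have "(\<Sum>i\<in>UNIV. v $ i) * a \<le> 0" for a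
    using key[of "\<chi> i. a" "c + a"] by (simp add: inner_vec_def dev_def sum_distrib_right)
  from this[of 1] this[of "-1"] show "(\<Sum>i\<in>UNIV. v $ i) = 0" by simp
qed

text \<open>As \<open>v\<close> has total 0, any \<open>t\<close> may be subtracted from all
  coordinates of \<open>y\<close>; taking a median of \<open>y\<close> and using the degree bounds
  gives \<open>v \<bullet> y \<le> N G y\<close>. At \<open>x\<close> the assumption
  \<open>eq\<close> gives the reverse inequality.\<close>

lemma subdifferential_N_I:
  fixes x v :: "real ^ 'n::finite"
  assumes le: "\<And>i. \<bar>v $ i\<bar> \<le> deg G i" and sum0: "(\<Sum>i\<in>UNIV. v $ i) = 0"
    and eq: "dev G x c \<le> v \<bullet> x"
  shows "v \<in> subdifferential (N G) x"
proof -
  have "v \<bullet> y \<le> N G y" for y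
  proof -
    obtain t where t: "t \<in> median G y"
      using median_nonempty by blast
    have "v \<bullet> y = v \<bullet> y - (\<Sum>i\<in>UNIV. v $ i) * t"
      using sum0 by simp
    also have "\<dots> = (\<Sum>i\<in>UNIV. v $ i * (y $ i - t))"
      by (simp add: inner_vec_def right_diff_distrib sum_subtractf sum_distrib_right)
    also have "\<dots> \<le> dev G y t"
      unfolding dev_def
    proof (rule sum_mono)
      fix i
      have "v $ i * (y $ i - t) \<le> \<bar>v $ i\<bar> * \<bar>y $ i - t\<bar>"
        by (simp flip: abs_mult)
      also have "\<dots> \<le> deg G i * \<bar>y $ i - t\<bar>"
        by (intro mult_right_mono le) auto
      finally show "v $ i * (y $ i - t) \<le> deg G i * \<bar>y $ i - t\<bar>" .
    qed
    finally show ?thesis using N_attained[OF t] by simp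
  qed
  moreover have "N G x \<le> v \<bullet> x"
    using N_le_dev eq order_trans by blast
  ultimately show ?thesis
    by (smt (verit) inner_diff_right mem_Collect_eq subdifferential_def)
qed

section \<open>Symmetry under negation\<close>

lemma Sgn_uminus: "z \<in> Sgn t \<Longrightarrow> - z \<in> Sgn (- t)"
  by (auto simp: Sgn_def split: if_splits)

lemma Sgn_mult_nonneg: "z \<in> Sgn t \<Longrightarrow> 0 \<le> z * t"
  by (auto simp: Sgn_def split: if_splits)

lemma Delta1_uminus:
  assumes "a \<in> Delta1 G x"
  shows "- a \<in> Delta1 G (- x)"
proof -
  obtain z where z: "\<And>i j. (i, j) \<in> parcs G \<Longrightarrow> z i j \<in> Sgn (x $ i - x $ j)"
      "\<And>i j. (i, j) \<in> parcs G \<Longrightarrow> z i j = - z j i"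
    and a: "a = (\<chi> i. \<Sum>j | (i, j) \<in> parcs G. z i j)"
    using assms unfolding Delta1_def by blast
  have "- z i j \<in> Sgn ((- x) $ i - (- x) $ j)" if "(i, j) \<in> parcs G" for i j
    using Sgn_uminus[OF z(1)[OF that]] by simp
  moreover have "- z i j = - (- z j i)" if "(i, j) \<in> parcs G" for i j
    using z(2)[OF that] by simp
  moreover have "- a = (\<chi> i. \<Sum>j | (i, j) \<in> parcs G. - z i j)"
    by (simp add: a vec_eq_iff sum_negf)
  ultimately show ?thesis
    unfolding Delta1_def by (intro CollectI exI[of _ "\<lambda>i j. - z i j"]) blast
qed

text \<open>Every term of the equation is odd in \<open>x\<close>. This carries results on
  \<open>D_plus\<close> over to \<open>D_minus\<close>, and a median at the maximum over to one at
  the minimum.\<close>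

lemma AC_eigenpair_uminus:
  assumes "AC_eigenpair G \<mu> x"
  shows "AC_eigenpair G \<mu> (- x)"
proof -
  obtain a b c where abc: "a \<in> Delta1 G x" "b \<in> subdifferential infnorm x"
      "c \<in> subdifferential (N G) x" and eq: "0 = a - (2 * \<mu> * vol G) *\<^sub>R b + \<mu> *\<^sub>R c"
    and "x \<noteq> 0"
    using assms by (auto simp: AC_eigenpair_def)
  have "0 = - a - (2 * \<mu> * vol G) *\<^sub>R (- b) + \<mu> *\<^sub>R (- c)"
    using arg_cong[OF eq, of uminus] by (simp add: algebra_simps)
  moreover have "- a \<in> Delta1 G (- x)" "- b \<in> subdifferential infnorm (- x)"
      "- c \<in> subdifferential (N G) (- x)"
    using abc by (auto simp: Delta1_uminus subdifferential_uminus infnorm_neg N_uminus)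
  ultimately show ?thesis
    using \<open>x \<noteq> 0\<close> unfolding AC_eigenpair_def by fastforce
qed

lemma D_plus_uminus: "D_plus (- x) = D_minus x"
  and D_minus_uminus: "D_minus (- x) = D_plus x"
  and D_zero_uminus: "D_zero (- x) = D_zero x"
  by (auto simp: D_plus_def D_minus_def D_zero_def infnorm_neg)

section \<open>Components as vertex sets\<close>

text \<open>Replaces components by what the counting uses: disjoint nonempty sets closed under
  adjacency within \<open>S\<close>. In a symmetric graph connected and strongly connected subgraphs
  agree, so the vertex sets of the strongly connected components serve.\<close>

lemma num_components_le_card:
  fixes G :: "'n::finite pair_pre_digraph"
  assumes "pair_graph G"
  obtains \<C> where "num_components G S \<le> card \<C>" "disjoint \<C>" "\<Union>\<C> \<subseteq> S"
    "\<And>A. A \<in> \<C> \<Longrightarrow> A \<noteq> {}"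
    "\<And>A i j. A \<in> \<C> \<Longrightarrow> i \<in> A \<Longrightarrow> j \<in> S \<Longrightarrow> (i, j) \<in> parcs G \<Longrightarrow> j \<in> A"
proof -
  interpret pair_graph G by fact
  let ?H = "with_proj G \<restriction> S"
  interpret H: wf_digraph ?H
    by (rule wellformed_induce_subgraph)
  have "symmetric ?H"
    by (auto simp: symmetric_conv intro: arcs_symmetric)
  \<comment> \<open>Adding arcs on the same vertices preserves connectedness; hence a maximal
    connected subgraph is induced and inherits symmetry.\<close>
  have mono: "arc_mono (Digraph_Component.connected :: ('n, 'n \<times> 'n) pre_digraph \<Rightarrow> bool)"
    by (auto simp: arc_mono_def)
      (metis spanning_def subgraphE wf_digraph.connected_spanning_imp_connected)
  have "K \<in> H.sccs" if K: "H.max_subgraph Digraph_Component.connected K" for K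
  proof -
    have ind: "induced_subgraph K ?H"
      by (rule H.induced_subgraphI_arc_mono[OF K mono])
    then have "symmetric K"
      using \<open>symmetric ?H\<close> by (rule induced_graph_imp_symmetric[rotated])
    moreover have wf: "wf_digraph K"
      using ind by (auto simp: induced_subgraph_def subgraph_def)
    ultimately have "strongly_connected K"
      using H.max_subgraph_prop[OF K] by (simp add: wf_digraph.symmetric_connected_imp_strongly_connected)
    moreover have "Digraph_Component.connected L" if "strongly_connected L" for L :: "('n, 'n \<times> 'n) pre_digraph"
      using that rtrancl_on_mono[of "arcs_ends L" "(arcs_ends L)\<^sup>s" "verts L" "verts L"]
      by (auto simp: connected_conv strongly_connected_def reachable_def symcl_def)
    ultimately show ?thesis
      using H.max_subgraph_mp[OF K] by (simp add: H.sccs_altdef2)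
  qed
  then have "{K. H.max_subgraph Digraph_Component.connected K} \<subseteq> H.sccs"
    by blast
  moreover have "finite H.sccs"
    using H.inj_on_verts_sccs by (rule finite_imageD[rotated]) simp
  ultimately have "num_components G S \<le> card H.sccs_verts"
    unfolding num_components_def H.card_sccs_verts by (intro card_mono)
  moreover have "disjoint H.sccs_verts"
    using H.sccs_verts_disjoint by (auto simp: disjoint_def)
  moreover have "\<Union>H.sccs_verts \<subseteq> S"
    using H.sccs_verts_subsets by auto
  moreover have "j \<in> A" if "A \<in> H.sccs_verts" "i \<in> A" "j \<in> S" "(i, j) \<in> parcs G" for A i j
  proof -
    have "i \<in> S"
      using \<open>\<Union>H.sccs_verts \<subseteq> S\<close> that by blast
    then have "(i, j) \<in> arcs_ends ?H" "(j, i) \<in> arcs_ends ?H"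
      using that arcs_symmetric by (auto simp: arcs_ends_conv image_iff)
    then have "i \<rightarrow>\<^sup>*\<^bsub>?H\<^esub> j" "j \<rightarrow>\<^sup>*\<^bsub>?H\<^esub> i"
      by auto
    then show ?thesis
      using that(1)[unfolded H.in_sccs_verts_conv_reachable] that(2) by metis
  qed
  moreover have "A \<noteq> {}" if "A \<in> H.sccs_verts" for A
    using that[unfolded H.in_sccs_verts_conv_reachable] by (rule conjunct1)
  ultimately show thesis
    by (intro that[of H.sccs_verts])
qed

section \<open>Eigenvectors from cuts\<close>

lemma vol_pos:
  assumes "parcs G \<noteq> {}"
  shows "0 < vol (G :: 'n::finite pair_pre_digraph)"
proof -
  obtain i j where "(i, j) \<in> parcs G"
    using assms by auto
  then have "0 < deg G i"
    by (auto simp: deg_def out_degree_def out_arcs_def card_gt_0_iff)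
  then show ?thesis
    unfolding vol_def by (intro sum_pos2[of _ i]) (auto simp: deg_nonneg)
qed

lemma vol_Compl: "vol G = sum (deg G) A + sum (deg G) (- A)"
  unfolding vol_def by (subst sum.union_disjoint[symmetric]) (auto simp: Compl_partition)

text \<open>If no arc left \<open>S\<close>, every vertex reachable from \<open>S\<close> would lie
  in \<open>S\<close>. Positivity makes the eigenvalue of a cut nonzero, so that minimality of \<mu>
  applies to it.\<close>

lemma edge_cut_pos:
  fixes G :: "'n::finite pair_pre_digraph"
  assumes "pair_graph G" "pverts G = UNIV" "Digraph_Component.connected (with_proj G)"
    and "S \<noteq> {}" "S \<noteq> UNIV"
  shows "0 < edge_cut (parcs G) S (- S)"
proof -
  interpret pair_graph G by fact
  have "\<exists>i\<in>S. \<exists>j\<in>- S. (i, j) \<in> parcs G"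
  proof (rule ccontr)
    assume contra: "\<not> ?thesis"
    obtain a b where "a \<in> S" "b \<notin> S"
      using assms by auto
    have "strongly_connected (with_proj G)"
      using assms sym_arcs by (intro symmetric_connected_imp_strongly_connected)
    then have "a \<rightarrow>\<^sup>*\<^bsub>with_proj G\<^esub> b"
      using assms by (auto simp: strongly_connected_def)
    then have "(a, b) \<in> rtrancl_on UNIV (parcs G)"
      using assms by (simp add: reachable_def)
    then have "b \<in> S"
      using \<open>a \<in> S\<close> contra by (induction rule: rtrancl_on_induct) auto
    with \<open>b \<notin> S\<close> show False by simp
  qed
  then obtain i j where ij: "i \<in> S" "j \<in> - S" "(i, j) \<in> parcs G"
    by blast
  have "0 < (\<Sum>j\<in>- S. of_bool ((i, j) \<in> parcs G) :: real)"
    using ij(2,3) by (intro sum_pos2[of _ j]) auto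
  then show ?thesis
    unfolding edge_cut_def using ij(1) by (intro sum_pos2[of S i]) (auto intro: sum_nonneg)
qed

text \<open>Across the boundary of an extremal level set, or of a component of one, the flow is
  constantly 1 or -1; its net outflow then counts boundary edges.\<close>

lemma sum_cut_sign:
  fixes E :: "('n::finite \<times> 'n) set" and w :: "'n \<Rightarrow> 'n \<Rightarrow> real"
  assumes "\<And>i j. w i j = - w j i" and "\<And>i j. (i, j) \<notin> E \<Longrightarrow> w i j = 0"
    and "\<And>i j. i \<in> A \<Longrightarrow> j \<in> - A \<Longrightarrow> (i, j) \<in> E \<Longrightarrow> w i j = s"
  shows "(\<Sum>i\<in>A. \<Sum>j\<in>UNIV. w i j) = s * edge_cut E A (- A)"
proof -
  have "w i j = s * of_bool ((i, j) \<in> E)" if "i \<in> A" "j \<in> - A" for i j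
    using assms(2,3) that by auto
  then have "(\<Sum>i\<in>A. \<Sum>j\<in>- A. w i j) = (\<Sum>i\<in>A. \<Sum>j\<in>- A. s * of_bool ((i, j) \<in> E))"
    by (intro sum.cong refl)
  then show ?thesis
    unfolding edge_cut_def sum_antisym_boundary[OF assms(1)] by (simp only: sum_distrib_left)
qed

text \<open>
  With zero flow inside both sides and \<open>v\<close> constant on each side relative to the degrees, the
  eigenvalue equation determines \<open>u\<close>; both summands of \<open>u\<close> have the sign of \<open>x\<close>, so \<open>u\<close> is a
  subgradient of the norm as soon as \<open>u \<bullet> x = 1\<close>, which fixes the eigenvalue.
\<close>

lemma cut_eigenpair:
  fixes G :: "'n::finite pair_pre_digraph"
  assumes "pair_graph G" and "S \<noteq> {}" "S \<noteq> UNIV"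
    and small: "sum (deg G) S \<le> sum (deg G) (- S)"
    and pos: "0 < edge_cut (parcs G) S (- S)" "0 < vol G"
  shows "AC_eigenpair G (edge_cut (parcs G) S (- S) / sum (deg G) (- S)) (\<chi> i. if i \<in> S then 1 else - 1)"
proof -
  interpret pair_graph G by fact
  define x :: "real ^ 'n" where "x = (\<chi> i. if i \<in> S then 1 else - 1)"
  define p q where "p = sum (deg G) S" and "q = sum (deg G) (- S)"
  define h where "h = edge_cut (parcs G) S (- S) / q"
  \<comment> \<open>Halving turns the differences 2 and -2 across the cut into signs; inside a side
    the flow is 0.\<close>
  define w where "w i j = (if (i, j) \<in> parcs G then (x $ i - x $ j) / 2 else 0)" for i j
  \<comment> \<open>The factor \<open>p / q\<close> makes the total 0, and \<open>p \<le> q\<close>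
    keeps the entries within the degrees.\<close>
  define v :: "real ^ 'n" where "v = (\<chi> i. if i \<in> S then deg G i else - (p / q) * deg G i)"
  define f :: "'n \<Rightarrow> real" where "f i = (\<Sum>j\<in>UNIV. w i j)" for i
  \<comment> \<open>The eigenvalue equation solved for \<open>u\<close>.\<close>
  define u :: "real ^ 'n" where "u = (\<chi> i. (f i + h * v $ i) / (2 * h * vol G))"
  have vol: "vol G = p + q"
    unfolding p_def q_def by (rule vol_Compl)
  have "0 \<le> p"
    unfolding p_def by (simp add: sum_nonneg deg_nonneg)
  have "0 < q"
    using small pos vol unfolding p_def q_def by linarith
  have "0 < h"
    unfolding h_def using pos \<open>0 < q\<close> by simp
  have infnorm_x: "infnorm x = 1"
  proof (rule antisym)
    show "infnorm x \<le> 1"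
      by (rule infnorm_le_cart) (simp add: x_def)
    show "1 \<le> infnorm x"
      using component_le_infnorm_cart[of x undefined] by (auto simp: x_def split: if_splits)
  qed
  have anti: "w i j = - w j i" for i j
    using arcs_symmetric by (auto simp: w_def field_simps)
  have f_S: "sum f S = edge_cut (parcs G) S (- S)"
    unfolding f_def by (subst sum_cut_sign[where s = 1, OF anti]) (auto simp: w_def x_def)
  have "sum f UNIV = 0"
    unfolding f_def by (rule sum_antisym_eq_0[OF anti])
  moreover have "sum f UNIV = sum f S + sum f (- S)"
    by (subst sum.union_disjoint[symmetric]) (auto simp: Compl_partition)
  ultimately have f_C: "sum f (- S) = - edge_cut (parcs G) S (- S)"
    using f_S by simp
  have f_x: "0 \<le> f i * x $ i" for i
    unfolding f_def sum_distrib_right by (intro sum_nonneg) (auto simp: w_def x_def)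
  have v_x: "0 \<le> v $ i * x $ i" for i
    using \<open>0 \<le> p\<close> \<open>0 < q\<close> by (simp add: v_def x_def deg_nonneg)
  have split: "(\<Sum>i\<in>UNIV. g i) = sum g S + sum g (- S)" for g :: "'n \<Rightarrow> real"
    by (subst sum.union_disjoint[symmetric]) (auto simp: Compl_partition)
  have v_S: "(\<Sum>i\<in>S. v $ i) = p"
    unfolding p_def by (rule sum.cong) (auto simp: v_def)
  have "(\<Sum>i\<in>- S. v $ i) = (\<Sum>i\<in>- S. - (p / q) * deg G i)"
    by (rule sum.cong) (auto simp: v_def)
  also have "\<dots> = - (p / q) * q"
    unfolding q_def by (rule sum_distrib_left[symmetric])
  also have "\<dots> = - p"
    using \<open>0 < q\<close> by simp
  finally have v_C: "(\<Sum>i\<in>- S. v $ i) = - p" .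
  have x_sum: "(\<Sum>i\<in>UNIV. g i * x $ i) = sum g S - sum g (- S)" for g
    unfolding split by (simp add: x_def sum_negf)
  have u_x_nth: "u $ i * x $ i = (f i * x $ i + h * (v $ i * x $ i)) / (2 * h * vol G)" for i
    by (simp add: u_def distrib_right)
  have "u \<bullet> x = ((\<Sum>i\<in>UNIV. f i * x $ i) + h * (\<Sum>i\<in>UNIV. v $ i * x $ i)) / (2 * h * vol G)"
    by (simp add: inner_vec_def u_x_nth sum.distrib sum_distrib_left flip: sum_divide_distrib)
  \<comment> \<open>The flow contributes twice the cut, that is \<open>2 * (h * q)\<close>, and
    \<open>v\<close> contributes \<open>2 * p\<close>. Since \<open>p + q\<close> is the volume,
    this \<open>h\<close> is the value that makes the quotient 1.\<close>
  also have "\<dots> = (2 * (h * q) + h * (2 * p)) / (2 * h * vol G)"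
    unfolding x_sum f_S f_C v_S v_C using \<open>0 < q\<close> by (simp add: h_def)
  also have "\<dots> = 1"
  proof -
    have "2 * (h * q) + h * (2 * p) = 2 * h * vol G"
      by (simp add: vol algebra_simps)
    then show ?thesis
      using \<open>0 < h\<close> pos by simp
  qed
  finally have u_x: "u \<bullet> x = 1" .
  have "\<bar>u $ i\<bar> = u $ i * x $ i" for i
  proof -
    have "0 \<le> u $ i * x $ i"
      unfolding u_x_nth using f_x[of i] v_x[of i] \<open>0 < h\<close> pos by simp
    then show ?thesis
      by (auto simp: x_def)
  qed
  then have "(\<Sum>i\<in>UNIV. \<bar>u $ i\<bar>) \<le> 1"
    using u_x by (simp add: inner_vec_def)
  then have u: "u \<in> subdifferential infnorm x"
    unfolding subdifferential_infnorm using u_x infnorm_x by simp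
  have v: "v \<in> subdifferential (N G) x"
  proof (rule subdifferential_N_I)
    show "\<bar>v $ i\<bar> \<le> deg G i" for i
    proof -
      have "0 \<le> p / q" "p / q \<le> 1"
        using \<open>0 \<le> p\<close> \<open>0 < q\<close> small by (simp_all add: p_def q_def)
      then have "\<bar>p / q * deg G i\<bar> \<le> deg G i"
        using deg_nonneg[of G i] by (simp add: mult_left_le_one_le del: times_divide_eq_left)
      then show ?thesis
        using deg_nonneg[of G i] by (simp add: v_def)
    qed
    show "(\<Sum>i\<in>UNIV. v $ i) = 0"
      unfolding split v_S v_C by simp
    \<comment> \<open>The value -1 sits on the heavier side, hence is a median.\<close>
    have "dev G x (- 1) = 2 * p"
      unfolding dev_def split by (simp add: x_def p_def flip: sum_distrib_right)
    then show "dev G x (- 1) \<le> v \<bullet> x"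
      by (simp add: inner_vec_def x_sum v_S v_C)
  qed
  have "(\<chi> i. \<Sum>j | (i, j) \<in> parcs G. w i j) \<in> Delta1 G x"
    unfolding Delta1_def
    by (intro CollectI exI[of _ w] conjI refl allI impI anti) (auto simp: w_def x_def Sgn_def)
  moreover have "(\<Sum>j | (i, j) \<in> parcs G. w i j) = f i" for i
    unfolding f_def by (rule sum.mono_neutral_left) (auto simp: w_def)
  moreover have "0 = (\<chi> i. f i) - (2 * h * vol G) *\<^sub>R u + h *\<^sub>R v"
    using \<open>0 < h\<close> pos by (simp add: vec_eq_iff u_def)
  moreover have "x \<noteq> 0"
    using infnorm_x by (auto simp: infnorm_0)
  ultimately have "AC_eigenpair G h x"
    using u v unfolding AC_eigenpair_def by auto
  then show ?thesis
    by (simp add: h_def q_def x_def)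
qed

section \<open>Consequences of the eigenvalue equation\<close>

text \<open>Extending the edge variables by 0 to non-arcs makes the flow antisymmetric on all pairs,
  so the summation lemmas apply to it.\<close>

lemma AC_eigenpairE:
  fixes G :: "'n::finite pair_pre_digraph"
  assumes "pair_graph G" and "AC_eigenpair G \<mu> x"
  obtains w u v where "\<And>i j. w i j = - w j i" "\<And>i j. (i, j) \<notin> parcs G \<Longrightarrow> w i j = 0"
    "\<And>i j. (i, j) \<in> parcs G \<Longrightarrow> w i j \<in> Sgn (x $ i - x $ j)"
    "\<And>i. (\<Sum>j\<in>UNIV. w i j) = \<mu> * (2 * vol G * u $ i - v $ i)"
    "u \<in> subdifferential infnorm x" "v \<in> subdifferential (N G) x"
proof -
  interpret pair_graph G by fact
  obtain a u v where a: "a \<in> Delta1 G x" and uv: "u \<in> subdifferential infnorm x"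
      "v \<in> subdifferential (N G) x" and eq: "0 = a - (2 * \<mu> * vol G) *\<^sub>R u + \<mu> *\<^sub>R v"
    using assms by (auto simp: AC_eigenpair_def)
  obtain z where z: "\<And>i j. (i, j) \<in> parcs G \<Longrightarrow> z i j \<in> Sgn (x $ i - x $ j) \<and> z i j = - z j i"
    and a_z: "a = (\<chi> i. \<Sum>j | (i, j) \<in> parcs G. z i j)"
    using a unfolding Delta1_def by blast
  define w where "w i j = (if (i, j) \<in> parcs G then z i j else 0)" for i j
  have "(\<Sum>j\<in>UNIV. w i j) = \<mu> * (2 * vol G * u $ i - v $ i)" for i
  proof -
    have "(\<Sum>j\<in>UNIV. w i j) = (\<Sum>j | (i, j) \<in> parcs G. z i j)"
      by (rule sum.mono_neutral_cong_right) (auto simp: w_def)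
    also have "\<dots> = a $ i"
      by (simp add: a_z)
    also have "\<dots> = \<mu> * (2 * vol G * u $ i - v $ i)"
      using arg_cong[OF eq, of "\<lambda>y. y $ i"] by (simp add: algebra_simps)
    finally show ?thesis .
  qed
  moreover have "w i j = - w j i" for i j
  proof (cases "(i, j) \<in> parcs G")
    case True
    with z[OF True] arcs_symmetric[OF True] show ?thesis
      by (simp add: w_def)
  next
    case False
    with arcs_symmetric[of j i] show ?thesis
      by (auto simp: w_def)
  qed
  moreover have "w i j = 0" if "(i, j) \<notin> parcs G" for i j
    using that by (simp add: w_def)
  moreover have "w i j \<in> Sgn (x $ i - x $ j)" if "(i, j) \<in> parcs G" for i j
    using conjunct1[OF z[OF that]] that by (simp add: w_def)
  ultimately show thesis
    using uv by (intro that[of w u v])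
qed

text \<open>Summed over all vertices, the flow and \<open>v\<close> cancel, so \<open>u\<close> has
  total 0. The weights of \<open>T\<close> and \<open>- T\<close> are therefore opposite, and their
  absolute values add up to at most 1.\<close>

lemma eigenpair_weight_bounds:
  fixes G :: "'n::finite pair_pre_digraph"
  assumes "parcs G \<noteq> {}" "\<mu> \<noteq> 0"
    and w: "\<And>i j. w i j = - w j i"
    and eq: "\<And>i. (\<Sum>j\<in>UNIV. w i j) = \<mu> * (2 * vol G * u $ i - v $ i)"
    and u: "u \<in> subdifferential infnorm x" and v: "v \<in> subdifferential (N G) x"
  shows "\<bar>\<Sum>i\<in>T. u $ i\<bar> \<le> 1 / 2"
proof -
  obtain c where c: "c \<in> median G x"
    using median_nonempty by blast
  have "0 = (\<Sum>i\<in>UNIV. \<Sum>j\<in>UNIV. w i j)"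
    by (rule sum_antisym_eq_0[OF w, symmetric])
  also have "\<dots> = \<mu> * (2 * vol G * (\<Sum>i\<in>UNIV. u $ i) - (\<Sum>i\<in>UNIV. v $ i))"
    by (simp add: eq sum_subtractf flip: sum_distrib_left)
  finally have "(\<Sum>i\<in>UNIV. u $ i) = 0"
    using assms(1,2) vol_pos[of G] subdifferential_N_D(4)[OF v c] by simp
  moreover have split: "sum g UNIV = sum g T + sum g (- T)" for g :: "'n \<Rightarrow> real"
    by (subst sum.union_disjoint[symmetric]) (auto simp: Compl_partition)
  moreover have "(\<Sum>i\<in>UNIV. \<bar>u $ i\<bar>) \<le> 1"
    using u by (simp add: subdifferential_infnorm)
  moreover have "\<bar>\<Sum>i\<in>T. u $ i\<bar> \<le> (\<Sum>i\<in>T. \<bar>u $ i\<bar>)" "\<bar>\<Sum>i\<in>- T. u $ i\<bar> \<le> (\<Sum>i\<in>- T. \<bar>u $ i\<bar>)"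
    by (rule sum_abs)+
  ultimately show ?thesis
    using split[of "\<lambda>i. u $ i"] split[of "\<lambda>i. \<bar>u $ i\<bar>"] by linarith
qed

text \<open>Complementary slackness: the gaps in the coordinatewise bound on
  \<open>u \<bullet> x\<close> are nonnegative and their sum is at most 0, so each of them
  vanishes.\<close>

lemma subdifferential_infnorm_zero:
  fixes x u :: "real ^ 'n"
  assumes "u \<in> subdifferential infnorm x" "\<bar>x $ i\<bar> < infnorm x"
  shows "u $ i = 0"
proof -
  have le: "0 \<le> \<bar>u $ j\<bar> * infnorm x - u $ j * x $ j" for j
  proof -
    have "u $ j * x $ j \<le> \<bar>u $ j\<bar> * \<bar>x $ j\<bar>"
      by (simp flip: abs_mult)
    also have "\<dots> \<le> \<bar>u $ j\<bar> * infnorm x"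
      by (intro mult_left_mono component_le_infnorm_cart) auto
    finally show ?thesis by simp
  qed
  have "(\<Sum>j\<in>UNIV. \<bar>u $ j\<bar> * infnorm x - u $ j * x $ j)
      = (\<Sum>j\<in>UNIV. \<bar>u $ j\<bar>) * infnorm x - u \<bullet> x"
    by (simp add: sum_subtractf inner_vec_def sum_distrib_right)
  also have "\<dots> \<le> 0"
    using assms(1) by (simp add: subdifferential_infnorm infnorm_pos_le mult_left_le_one_le sum_nonneg)
  finally have "(\<Sum>j\<in>UNIV. \<bar>u $ j\<bar> * infnorm x - u $ j * x $ j) = 0"
    using le by (simp add: sum_nonneg order_antisym)
  then have "\<bar>u $ i\<bar> * infnorm x = u $ i * x $ i"
    using le by (simp add: sum_nonneg_eq_0_iff)
  also have "\<dots> \<le> \<bar>u $ i\<bar> * \<bar>x $ i\<bar>"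
    by (simp flip: abs_mult)
  finally have "\<bar>u $ i\<bar> * (infnorm x - \<bar>x $ i\<bar>) \<le> 0"
    by (simp add: algebra_simps)
  then show ?thesis
    using assms(2) by (simp add: mult_le_0_iff)
qed

text \<open>Pair the equation with \<open>x\<close>: the flow side is a nonnegative energy, and the
  factor of \<mu> is positive because \<open>v \<bullet> x\<close> is at most
  \<open>vol G * infnorm x\<close>.\<close>

lemma AC_eigenvalue_nonneg:
  fixes G :: "'n::finite pair_pre_digraph"
  assumes "pair_graph G" "parcs G \<noteq> {}" "AC_eigenpair G \<mu> x"
  shows "0 \<le> \<mu>"
proof -
  obtain w u v where w: "\<And>i j. w i j = - w j i" "\<And>i j. (i, j) \<notin> parcs G \<Longrightarrow> w i j = 0"
      "\<And>i j. (i, j) \<in> parcs G \<Longrightarrow> w i j \<in> Sgn (x $ i - x $ j)"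
    and eq: "\<And>i. (\<Sum>j\<in>UNIV. w i j) = \<mu> * (2 * vol G * u $ i - v $ i)"
    and u: "u \<in> subdifferential infnorm x" and v: "v \<in> subdifferential (N G) x"
    using AC_eigenpairE[OF assms(1,3)] by blast
  obtain c where c: "c \<in> median G x"
    using median_nonempty by blast
  have "x \<noteq> 0"
    using assms(3) by (simp add: AC_eigenpair_def)
  then have "0 < infnorm x"
    by (simp add: infnorm_pos_lt)
  then have M: "0 < vol G * infnorm x"
    using vol_pos[OF assms(2)] by simp
  have "0 \<le> w i j * (x $ i - x $ j)" for i j
    using w(2)[of i j] Sgn_mult_nonneg[OF w(3)[of i j]] by (cases "(i, j) \<in> parcs G") auto
  then have "0 \<le> 2 * (\<Sum>i\<in>UNIV. (\<Sum>j\<in>UNIV. w i j) * x $ i)"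
    by (subst sum_antisym_weighted[OF w(1)]) (simp add: sum_nonneg)
  also have "(\<Sum>i\<in>UNIV. (\<Sum>j\<in>UNIV. w i j) * x $ i) = \<mu> * (2 * vol G * (u \<bullet> x) - v \<bullet> x)"
    by (simp add: eq inner_vec_def sum_distrib_left algebra_simps flip: sum_subtractf)
  also have "u \<bullet> x = infnorm x"
    using u by (simp add: subdifferential_infnorm)
  finally have nonneg: "0 \<le> \<mu> * (2 * vol G * infnorm x - v \<bullet> x)"
    by simp
  have "v \<bullet> x \<le> (\<Sum>i\<in>UNIV. deg G i * infnorm x)"
    unfolding inner_vec_def
  proof (rule sum_mono)
    fix i
    have "v $ i \<bullet> x $ i \<le> \<bar>v $ i\<bar> * \<bar>x $ i\<bar>"
      by (simp flip: abs_mult)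
    also have "\<dots> \<le> deg G i * infnorm x"
      by (intro mult_mono subdifferential_N_D(1)[OF v c] component_le_infnorm_cart deg_nonneg) auto
    finally show "v $ i \<bullet> x $ i \<le> deg G i * infnorm x" .
  qed
  then have "v \<bullet> x \<le> vol G * infnorm x"
    by (simp add: vol_def flip: sum_distrib_right)
  with M have "0 < 2 * vol G * infnorm x - v \<bullet> x"
    by linarith
  with nonneg show ?thesis
    by (simp add: zero_le_mult_iff)
qed

section \<open>The least eigenvalue and component counts\<close>

text \<open>Minimality is applied to the cut eigenvector of the lighter of \<open>A\<close> and
  \<open>- A\<close>, whose eigenvalue has the heavier volume as denominator.\<close>

lemma least_eigenvalue_le_cut:
  fixes G :: "'n::finite pair_pre_digraph"
  assumes G: "pair_graph G" "pverts G = UNIV" "parcs G \<noteq> {}"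
      "Digraph_Component.connected (with_proj G)"
    and "0 \<le> \<mu>" and least: "\<And>\<nu>. AC_eigenvalue G \<nu> \<Longrightarrow> \<nu> \<noteq> 0 \<Longrightarrow> \<mu> \<le> \<nu>"
    and "A \<noteq> {}"
  shows "\<mu> * (vol G - sum (deg G) A) \<le> edge_cut (parcs G) A (- A)"
proof (cases "A = UNIV")
  case True
  then show ?thesis
    by (simp add: vol_def edge_cut_def)
next
  case False
  interpret pair_graph G by fact
  have *: "\<mu> * sum (deg G) (- S) \<le> edge_cut (parcs G) S (- S)"
    if S: "S \<noteq> {}" "S \<noteq> UNIV" "sum (deg G) S \<le> sum (deg G) (- S)" for S
  proof -
    have cut: "0 < edge_cut (parcs G) S (- S)"
      using G S by (intro edge_cut_pos)
    have vol: "0 < vol G"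
      using G by (intro vol_pos)
    then have q: "0 < sum (deg G) (- S)"
      using S vol_Compl[of G S] by linarith
    have "AC_eigenvalue G (edge_cut (parcs G) S (- S) / sum (deg G) (- S))"
      unfolding AC_eigenvalue_def using cut_eigenpair[OF G(1) S cut vol] by blast
    then have "\<mu> \<le> edge_cut (parcs G) S (- S) / sum (deg G) (- S)"
      using cut q by (intro least) auto
    then show ?thesis
      using q by (simp add: field_simps)
  qed
  show ?thesis
  proof (cases "sum (deg G) A \<le> sum (deg G) (- A)")
    case True
    then show ?thesis
      using *[of A] False \<open>A \<noteq> {}\<close> vol_Compl[of G A] by simp
  next
    case nle: False
    \<comment> \<open>Here \<open>A\<close> is the heavier side, so replacing the volume of
      \<open>- A\<close> by that of \<open>A\<close> only enlarges the left side.\<close>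
    have "\<mu> * (vol G - sum (deg G) A) \<le> \<mu> * sum (deg G) A"
      using nle \<open>0 \<le> \<mu>\<close> vol_Compl[of G A] by (intro mult_left_mono) auto
    also have "\<dots> \<le> edge_cut (parcs G) (- A) A"
      using *[of "- A"] nle False \<open>A \<noteq> {}\<close> by auto
    also have "\<dots> = edge_cut (parcs G) A (- A)"
      using sym_arcs by (intro edge_cut_commute) (simp add: symmetric_def)
    finally show ?thesis .
  qed
qed

lemma num_components_D_plus_le_1:
  fixes G :: "'n::finite pair_pre_digraph"
  assumes G: "pair_graph G" "parcs G \<noteq> {}"
    and x: "AC_eigenpair G \<mu> x" and "0 < \<mu>"
    and cut: "\<And>A. A \<noteq> {} \<Longrightarrow> \<mu> * (vol G - sum (deg G) A) \<le> edge_cut (parcs G) A (- A)"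
    and c: "c \<in> median G x" "c < infnorm x"
  shows "num_components G (D_plus x) \<le> 1"
proof -
  obtain w u v where w: "\<And>i j. w i j = - w j i" "\<And>i j. (i, j) \<notin> parcs G \<Longrightarrow> w i j = 0"
      "\<And>i j. (i, j) \<in> parcs G \<Longrightarrow> w i j \<in> Sgn (x $ i - x $ j)"
    and eq: "\<And>i. (\<Sum>j\<in>UNIV. w i j) = \<mu> * (2 * vol G * u $ i - v $ i)"
    and u: "u \<in> subdifferential infnorm x" and v: "v \<in> subdifferential (N G) x"
    using AC_eigenpairE[OF G(1) x] by blast
  obtain \<C> where \<C>: "num_components G (D_plus x) \<le> card \<C>" "disjoint \<C>" "\<Union>\<C> \<subseteq> D_plus x"
      "\<And>A. A \<in> \<C> \<Longrightarrow> A \<noteq> {}"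
      "\<And>A i j. A \<in> \<C> \<Longrightarrow> i \<in> A \<Longrightarrow> j \<in> D_plus x \<Longrightarrow> (i, j) \<in> parcs G \<Longrightarrow> j \<in> A"
    by (rule num_components_le_card[OF G(1), where S = "D_plus x"]) blast
  have weight: "1 / 2 \<le> (\<Sum>i\<in>A. u $ i)" if A: "A \<in> \<C>" for A
  proof -
    have sub: "A \<subseteq> D_plus x"
      using \<C>(3) A by blast
    have "w i j = 1" if "i \<in> A" "j \<in> - A" "(i, j) \<in> parcs G" for i j
    proof -
      have "x $ i = infnorm x" "j \<notin> D_plus x"
        using sub that \<C>(5)[OF A] by (auto simp: D_plus_def)
      then have "x $ j < x $ i"
        using component_le_infnorm_cart[of x j] by (auto simp: D_plus_def)
      then show ?thesis
        using w(3)[OF that(3)] by (simp add: Sgn_def)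
    qed
    then have "edge_cut (parcs G) A (- A) = (\<Sum>i\<in>A. \<Sum>j\<in>UNIV. w i j)"
      using sum_cut_sign[OF w(1,2), where A = A and s = 1] by simp
    also have "\<dots> = \<mu> * (2 * vol G * (\<Sum>i\<in>A. u $ i) - (\<Sum>i\<in>A. v $ i))"
      by (simp add: eq sum_subtractf flip: sum_distrib_left)
    also have "(\<Sum>i\<in>A. v $ i) = sum (deg G) A"
      using sub c by (intro sum.cong refl subdifferential_N_D(2)[OF v c(1)]) (auto simp: D_plus_def)
    finally have "\<mu> * (vol G - sum (deg G) A) \<le> \<mu> * (2 * vol G * (\<Sum>i\<in>A. u $ i) - sum (deg G) A)"
      using cut[OF \<C>(4)[OF A]] by simp
    \<comment> \<open>The volume of \<open>A\<close> occurs on both sides and cancels.\<close>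
    then have "vol G \<le> 2 * vol G * (\<Sum>i\<in>A. u $ i)"
      using \<open>0 < \<mu>\<close> by simp
    then show ?thesis
      using vol_pos[OF G(2)] by simp
  qed
  have "real (card \<C>) * (1 / 2) \<le> (\<Sum>A\<in>\<C>. \<Sum>i\<in>A. u $ i)"
    using weight by (rule sum_bounded_below)
  also have "\<dots> = (\<Sum>i\<in>\<Union>\<C>. u $ i)"
    using \<C>(2) by (subst sum.Union_disjoint) (auto simp: disjoint_def)
  also have "\<dots> \<le> 1 / 2"
    using eigenpair_weight_bounds[OF G(2) _ w(1) eq u v, of "\<Union>\<C>"] \<open>0 < \<mu>\<close> by simp
  finally show ?thesis
    using \<C>(1) by simp
qed

text \<open>On \<open>D_zero x\<close> the subgradient \<open>u\<close> vanishes and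
  \<open>v\<close> is minus the degree, so every component has net outflow \<mu> times its volume.
  Combined with the cut bound, this gives each component a fixed share of the boundary of
  \<open>D_minus x\<close>, which has room for only two shares.\<close>

lemma num_components_D_zero_le_2:
  fixes G :: "'n::finite pair_pre_digraph"
  assumes G: "pair_graph G" "parcs G \<noteq> {}"
    and x: "AC_eigenpair G \<mu> x" and "0 < \<mu>"
    and cut: "\<And>A. A \<noteq> {} \<Longrightarrow> \<mu> * (vol G - sum (deg G) A) \<le> edge_cut (parcs G) A (- A)"
    and c: "infnorm x \<in> median G x"
  shows "num_components G (D_zero x) \<le> 2"
proof -
  interpret pair_graph G by fact
  obtain w u v where w: "\<And>i j. w i j = - w j i" "\<And>i j. (i, j) \<notin> parcs G \<Longrightarrow> w i j = 0"
      "\<And>i j. (i, j) \<in> parcs G \<Longrightarrow> w i j \<in> Sgn (x $ i - x $ j)"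
    and eq: "\<And>i. (\<Sum>j\<in>UNIV. w i j) = \<mu> * (2 * vol G * u $ i - v $ i)"
    and u: "u \<in> subdifferential infnorm x" and v: "v \<in> subdifferential (N G) x"
    using AC_eigenpairE[OF G(1) x] by blast
  obtain \<C> where \<C>: "num_components G (D_zero x) \<le> card \<C>" "disjoint \<C>" "\<Union>\<C> \<subseteq> D_zero x"
      "\<And>A. A \<in> \<C> \<Longrightarrow> A \<noteq> {}"
      "\<And>A i j. A \<in> \<C> \<Longrightarrow> i \<in> A \<Longrightarrow> j \<in> D_zero x \<Longrightarrow> (i, j) \<in> parcs G \<Longrightarrow> j \<in> A"
    by (rule num_components_le_card[OF G(1), where S = "D_zero x"]) blast
  have "0 < infnorm x"
    using x by (simp add: AC_eigenpair_def infnorm_pos_lt)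
  have D_cases: "i \<in> D_plus x \<or> i \<in> D_zero x \<or> i \<in> D_minus x" for i
    using component_le_infnorm_cart[of x i] by (auto simp: D_plus_def D_minus_def D_zero_def)
  have vol: "0 < vol G"
    by (rule vol_pos[OF G(2)])
  have to_minus: "\<mu> * vol G / 2 \<le> edge_cut (parcs G) A (D_minus x)" if A: "A \<in> \<C>" for A
  proof -
    have sub: "A \<subseteq> D_zero x"
      using \<C>(3) A by blast
    define e where "e i j = (of_bool ((i, j) \<in> parcs G) :: real)" for i j
    \<comment> \<open>Edges leaving \<open>A\<close> end at an extremal value: the flow is 1 towards
      \<open>D_minus x\<close> and -1 towards \<open>D_plus x\<close>.\<close>
    have "w i j = e i j * of_bool (j \<in> D_minus x) - e i j * of_bool (j \<in> D_plus x)
        \<and> e i j = e i j * of_bool (j \<in> D_minus x) + e i j * of_bool (j \<in> D_plus x)"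
      if "i \<in> A" "j \<in> - A" for i j
    proof (cases "(i, j) \<in> parcs G")
      case True
      have i: "\<bar>x $ i\<bar> < infnorm x"
        using sub that by (auto simp: D_zero_def)
      have "j \<notin> D_zero x"
        using \<C>(5)[OF A _ _ True] that by auto
      with D_cases consider "j \<in> D_plus x" | "j \<in> D_minus x"
        by blast
      then show ?thesis
        using w(3)[OF True] i True \<open>0 < infnorm x\<close>
        by cases (auto simp: e_def D_plus_def D_minus_def Sgn_def split: if_splits)
    qed (simp add: w(2) e_def)
    then have flow: "(\<Sum>i\<in>A. \<Sum>j\<in>- A. w i j)
          = (\<Sum>i\<in>A. \<Sum>j\<in>- A. e i j * of_bool (j \<in> D_minus x) - e i j * of_bool (j \<in> D_plus x))"
      and bdry: "(\<Sum>i\<in>A. \<Sum>j\<in>- A. e i j)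
          = (\<Sum>i\<in>A. \<Sum>j\<in>- A. e i j * of_bool (j \<in> D_minus x) + e i j * of_bool (j \<in> D_plus x))"
      by (intro sum.cong refl; blast)+
    have cut_restrict: "(\<Sum>i\<in>A. \<Sum>j\<in>- A. e i j * of_bool (j \<in> D)) = edge_cut (parcs G) A D"
      if "D \<subseteq> - A" for D
      unfolding edge_cut_def e_def using that
      by (intro sum.cong refl sum.mono_neutral_cong_right) auto
    have disj: "D_minus x \<subseteq> - A" "D_plus x \<subseteq> - A"
      using sub by (auto simp: D_plus_def D_minus_def D_zero_def)
    have "edge_cut (parcs G) A (D_minus x) - edge_cut (parcs G) A (D_plus x) = (\<Sum>i\<in>A. \<Sum>j\<in>UNIV. w i j)"
      unfolding sum_antisym_boundary[OF w(1)] flow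
      by (simp add: sum_subtractf cut_restrict[OF disj(1)] cut_restrict[OF disj(2)] del: sum_mult_of_bool_eq)
    also have "\<dots> = (\<Sum>i\<in>A. \<mu> * deg G i)"
    proof (rule sum.cong[OF refl])
      fix i assume "i \<in> A"
      then have "\<bar>x $ i\<bar> < infnorm x"
        using sub by (auto simp: D_zero_def)
      then show "(\<Sum>j\<in>UNIV. w i j) = \<mu> * deg G i"
        using subdifferential_infnorm_zero[OF u] subdifferential_N_D(3)[OF v c] by (simp add: eq)
    qed
    also have "\<dots> = \<mu> * sum (deg G) A"
      by (simp add: sum_distrib_left)
    finally have "edge_cut (parcs G) A (D_minus x) - edge_cut (parcs G) A (D_plus x) = \<mu> * sum (deg G) A" .
    moreover have "edge_cut (parcs G) A (- A) = edge_cut (parcs G) A (D_minus x) + edge_cut (parcs G) A (D_plus x)"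
      using bdry unfolding sum.distrib cut_restrict[OF disj(1)] cut_restrict[OF disj(2)]
      by (simp add: edge_cut_def e_def)
    \<comment> \<open>Adding net outflow and boundary size cancels the edges to
      \<open>D_plus x\<close> and counts those to \<open>D_minus x\<close> twice.\<close>
    ultimately show ?thesis
      using cut[OF \<C>(4)[OF A]] by (simp add: algebra_simps)
  qed
  have "real (card \<C>) * (\<mu> * vol G / 2) \<le> (\<Sum>A\<in>\<C>. edge_cut (parcs G) A (D_minus x))"
    using to_minus by (rule sum_bounded_below)
  also have "\<dots> = edge_cut (parcs G) (\<Union>\<C>) (D_minus x)"
    using \<C>(2) by (intro edge_cut_Union_left[symmetric]) auto
  also have "\<dots> \<le> edge_cut (parcs G) (- D_minus x) (D_minus x)"
    using \<C>(3) by (intro edge_cut_mono) (auto simp: D_zero_def D_minus_def)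
  also have "\<dots> = edge_cut (parcs G) (D_minus x) (- D_minus x)"
    using sym_arcs by (intro edge_cut_commute) (simp add: symmetric_def)
  also have "\<dots> = - (\<Sum>i\<in>D_minus x. \<Sum>j\<in>UNIV. w i j)"
  proof -
    have "w i j = - 1" if "i \<in> D_minus x" "j \<in> - D_minus x" "(i, j) \<in> parcs G" for i j
      using w(3)[OF that(3)] that component_le_infnorm_cart[of x j]
      by (auto simp: D_minus_def Sgn_def split: if_splits)
    then show ?thesis
      using sum_cut_sign[OF w(1,2), where A = "D_minus x" and s = "- 1"] by simp
  qed
  also have "\<dots> = - (\<mu> * (2 * vol G * (\<Sum>i\<in>D_minus x. u $ i) - (\<Sum>i\<in>D_minus x. v $ i)))"
    by (simp add: eq sum_subtractf flip: sum_distrib_left)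
  also have "\<dots> = \<mu> * (2 * vol G * - (\<Sum>i\<in>D_minus x. u $ i) + (\<Sum>i\<in>D_minus x. v $ i))"
    by (simp add: algebra_simps)
  also have "\<dots> \<le> \<mu> * vol G"
  proof -
    \<comment> \<open>The weight bound alone limits the boundary to \<mu> times the volume, as
      \<open>v\<close> is nonpositive on \<open>D_minus x\<close>.\<close>
    have "- (\<Sum>i\<in>D_minus x. u $ i) \<le> 1 / 2"
      using eigenpair_weight_bounds[OF G(2) _ w(1) eq u v, of "D_minus x"] \<open>0 < \<mu>\<close> by simp
    then have "2 * vol G * - (\<Sum>i\<in>D_minus x. u $ i) \<le> 2 * vol G * (1 / 2)"
      using vol by (intro mult_left_mono) auto
    moreover have "(\<Sum>i\<in>D_minus x. v $ i) \<le> 0"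
    proof (rule sum_nonpos)
      fix i assume "i \<in> D_minus x"
      then have "x $ i < infnorm x"
        using \<open>0 < infnorm x\<close> by (auto simp: D_minus_def)
      then show "v $ i \<le> 0"
        using subdifferential_N_D(3)[OF v c] deg_nonneg[of G i] by simp
    qed
    ultimately show ?thesis
      using \<open>0 < \<mu>\<close> by (intro mult_left_mono) auto
  qed
  finally have "real (card \<C>) * (\<mu> * vol G) \<le> 2 * (\<mu> * vol G)"
    by simp
  then have "real (card \<C>) \<le> 2"
    using \<open>0 < \<mu>\<close> vol by simp
  then show ?thesis
    using \<C>(1) by simp
qed

theorem theorem5p6:
  fixes G :: "'n::finite pair_pre_digraph" and \<mu> c :: real and x :: "real ^ 'n"
  assumes "pair_graph G" and "pverts G = UNIV" and "parcs G \<noteq> {}"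
    and "Digraph_Component.connected (with_proj G)"
    and "AC_eigenvalue G \<mu>" and "\<mu> \<noteq> 0"
    and "\<And>\<nu>. AC_eigenvalue G \<nu> \<Longrightarrow> \<nu> \<noteq> 0 \<Longrightarrow> \<mu> \<le> \<nu>"
    and "AC_eigenpair G \<mu> x"
    and "c \<in> median G x"
  shows "(c = infnorm x \<longrightarrow>
            num_components G (D_zero x) \<le> 2 \<and> num_components G (D_minus x) \<le> 1) \<and>
         (c = - infnorm x \<longrightarrow>
            num_components G (D_zero x) \<le> 2 \<and> num_components G (D_plus x) \<le> 1) \<and>
         (\<bar>c\<bar> < infnorm x \<longrightarrow>
            num_components G (D_plus x) \<le> 1 \<and> num_components G (D_minus x) \<le> 1)"
proof -
  have "0 \<le> \<mu>"
    using assms(1,3,8) by (rule AC_eigenvalue_nonneg)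
  with assms(6) have "0 < \<mu>"
    by simp
  have cut: "\<mu> * (vol G - sum (deg G) A) \<le> edge_cut (parcs G) A (- A)" if "A \<noteq> {}" for A
    using assms(1-4) \<open>0 \<le> \<mu>\<close> assms(7) that by (rule least_eigenvalue_le_cut)
  have neg: "AC_eigenpair G \<mu> (- x)" "- c \<in> median G (- x)"
    using assms(8,9) by (auto intro: AC_eigenpair_uminus median_uminus)
  have "0 < infnorm x"
    using assms(8) by (simp add: AC_eigenpair_def infnorm_pos_lt)
  note plus = num_components_D_plus_le_1[OF assms(1,3) _ \<open>0 < \<mu>\<close> cut]
  note zero = num_components_D_zero_le_2[OF assms(1,3) _ \<open>0 < \<mu>\<close> cut]
  \<comment> \<open>The condition on \<open>c\<close> is one-sided and thus serves both (b) and (c);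
    its mirror image for \<open>D_minus x\<close> serves (a) and (c).\<close>
  have "num_components G (D_plus x) \<le> 1" if "c < infnorm x"
    using plus[OF assms(8) _ assms(9) that] by simp
  moreover have "num_components G (D_minus x) \<le> 1" if "- infnorm x < c"
    using plus[OF neg(1) _ neg(2)] that by (simp add: infnorm_neg D_plus_uminus)
  moreover have "num_components G (D_zero x) \<le> 2" if "c = infnorm x"
    using zero[OF assms(8)] assms(9) that by simp
  moreover have "num_components G (D_zero x) \<le> 2" if "c = - infnorm x"
    using zero[OF neg(1)] neg(2) that by (simp add: infnorm_neg D_zero_uminus)
  ultimately show ?thesis
    using \<open>0 < infnorm x\<close> by auto
qed

end
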